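(* Let $n\ge 1$ be an integer, let $1\le p_2\le p_1<\infty$, and let $\Psi_1,\Psi_2:(0,\infty)\to(0,\infty)$ be measurable functions. Assume that there is a constant $A_1>0$ such that $\frac{1}{A_1}\le\frac{\Psi_1(s)}{\Psi_1(r)}\le A_1$ for all $r,s>0$ with $1\le\frac{s}{r}\le2$, and that there is a constant $A_3>0$ such that $\frac{\Psi_2(s)}{\Psi_2(r)}\le A_3$ for all $r,s>0$ with $1\le\frac{s}{r}\le 2$. If $$\int_0^1\frac{\Psi_1(t)^{p_2}\,\Psi_2(t)}{t}\,dt<\infty,$$ then $L^{p_1,\Psi_1}\subseteq S_{p_2,\Psi_2}$.
   Context: Let $B(x,r):=\{y\in\mathbb{R}^n:|x-y|<r\}$ and let $|E|$ denote Lebesgue measure. For $1\le p<\infty$ and a measurable function $\Psi:(0,\infty)\to(0,\infty)$: The generalized Morrey space $L^{p,\Psi}=L^{p,\Psi}(\mathbb{R}^n)$ is the set of all $f\in L^p_{\rm loc}(\mathbb{R}^n)$ with $$\|f\|_{L^{p,\Psi}}:=\sup_{x\in\mathbb{R}^n,\,r>0}\frac{|B(x,r)|^{-1/p}}{\Psi(r)}\left(\int_{B(x,r)}|f(y)|^p\,dy\right)^{1/p}<\infty.$$ The Stummel $p$-modulus of $f\in L^p_{\rm loc}(\mathbb{R}^n)$ is $$\eta_{p,\Psi}f(r):=\sup_{x\in\mathbb{R}^n}\left(\int_{|x-y|<r}\frac{|f(y)|^p\,\Psi(|x-y|)}{|x-y|^n}\,dy\right)^{1/p}\in[0,\infty],\quad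 r>0,$$ which is nondecreasing in $r$, and the generalized Stummel $p$-class is $S_{p,\Psi}=S_{p,\Psi}(\mathbb{R}^n):=\{f\in L^p_{\rm loc}(\mathbb{R}^n):\ \eta_{p,\Psi}f(r)\searrow 0 \text{ as } r\searrow 0\}$, i.e. $\lim_{r\to0^+}\eta_{p,\Psi}f(r)=0$. *)

theory Defs
  imports "HOL-Analysis.Analysis"
begin

text \<open>Positive real powers on \<open>[0,\<infinity>]\<close>, with \<open>\<infinity>\<close> raised to any positive power being \<open>\<infinity>\<close>;
  only used for exponents \<open>a > 0\<close>.\<close>

definition ennpowr :: "ennreal \<Rightarrow> real \<Rightarrow> ennreal" where
  "ennpowr x a = (if x = \<infinity> then \<infinity> else ennreal (enn2real x powr a))"

text \<open>The classes \<^class>\<open>real_normed_field\<close> and \<^class>\<open>euclidean_space\<close> together describe the scalar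
  type: real- and complex-valued functions are both covered. Functions are not identified up to
  null sets; all notions below are invariant under changes on null sets.\<close>

definition Lp_loc :: "real \<Rightarrow> (real^'n \<Rightarrow> 'b::{real_normed_field, euclidean_space}) set" where
  "Lp_loc p = {f. f \<in> borel_measurable lebesgue \<and>
     (\<forall>K. compact K \<longrightarrow> (\<integral>\<^sup>+ y \<in> K. ennreal (norm (f y) powr p) \<partial>lebesgue) < \<infinity>)}"

definition morrey_norm ::
  "real \<Rightarrow> (real \<Rightarrow> real) \<Rightarrow> (real^'n \<Rightarrow> 'b::{real_normed_field, euclidean_space}) \<Rightarrow> ennreal" where
  "morrey_norm p \<Psi> f =
     (SUP x. SUP r\<in>{0<..}.
        ennreal (measure lebesgue (ball x r) powr (- 1 / p) / \<Psi> r) *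
        ennpowr (\<integral>\<^sup>+ y \<in> ball x r. ennreal (norm (f y) powr p) \<partial>lebesgue) (1 / p))"

definition morrey_space ::
  "real \<Rightarrow> (real \<Rightarrow> real) \<Rightarrow> (real^'n \<Rightarrow> 'b::{real_normed_field, euclidean_space}) set" where
  "morrey_space p \<Psi> = {f \<in> Lp_loc p. morrey_norm p \<Psi> f < \<infinity>}"

text \<open>At \<open>y = x\<close> the integrand below is \<open>0\<close> because of division by zero, so \<open>\<Psi> 0\<close> plays no role.\<close>

definition stummel_modulus ::
  "real \<Rightarrow> (real \<Rightarrow> real) \<Rightarrow> (real^'n \<Rightarrow> 'b::{real_normed_field, euclidean_space}) \<Rightarrow> real \<Rightarrow> ennreal" where
  "stummel_modulus p \<Psi> f r =
     (SUP x. ennpowr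
        (\<integral>\<^sup>+ y \<in> {y. norm (x - y) < r}.
           ennreal (norm (f y) powr p * \<Psi> (norm (x - y)) / norm (x - y) ^ CARD('n)) \<partial>lebesgue)
        (1 / p))"

definition stummel_class ::
  "real \<Rightarrow> (real \<Rightarrow> real) \<Rightarrow> (real^'n \<Rightarrow> 'b::{real_normed_field, euclidean_space}) set" where
  "stummel_class p \<Psi> = {f \<in> Lp_loc p. (stummel_modulus p \<Psi> f \<longlongrightarrow> 0) (at_right 0)}"

end

theory Submission
  imports Defs
begin

text \<open>For \<open>s = \<bar>x - y\<bar>\<close> the doubling of \<open>\<Psi>\<^sub>2\<close> bounds the kernel \<open>\<Psi>\<^sub>2 s / s\<^sup>n\<close> by a constant times the
  integral of \<open>\<Psi>\<^sub>2 t / t\<^sup>n\<^sup>+\<^sup>1\<close> over \<open>s/2 < t \<le> s\<close>. Inserting this and exchanging the order of integration,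
  one is left with the integrals of the \<open>p\<^sub>2\<close>-th power of \<open>\<bar>f\<bar>\<close> over the balls \<open>B(x, 2t)\<close>, \<open>t < r\<close>, which
  the Morrey norm controls by \<open>t\<^sup>n\<close> times the \<open>p\<^sub>2\<close>-th power of \<open>\<Psi>\<^sub>1(t)\<close>. So the Stummel modulus at \<open>r\<close>
  is dominated, uniformly in \<open>x\<close>, by the tail over \<open>(0, r)\<close> of the convergent Dini-type integral.\<close>

section \<open>Lowering the exponent of integrability\<close>

text \<open>Split at the height \<open>L\<close>. Below it, \<open>a powr q\<close> is monotone in
  \<open>a\<close>; above it, write \<open>a powr q = a powr (q - p) * a powr p\<close> and use that
  the exponent \<open>q - p\<close> is not positive.\<close>

lemma powr_le_scaled_powr:
  fixes a L p q :: real
  assumes "0 \<le> a" "0 < L" "1 \<le> q" "q \<le> p"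
  shows "a powr q \<le> L powr q + L powr (q - p) * a powr p"
proof (cases "a \<le> L")
  case True
  then have "a powr q \<le> L powr q" using assms by (intro powr_mono2) auto
  then show ?thesis by (simp add: add_increasing2)
next
  case False
  then have "a powr (q - p) \<le> L powr (q - p)"
    using assms by (intro powr_mono2') auto
  then have "a powr (q - p) * a powr p \<le> L powr (q - p) * a powr p"
    by (intro mult_right_mono) auto
  then show ?thesis by (simp add: powr_add [symmetric] add_increasing)
qed

text \<open>The height \<open>L\<close> stays free: \<open>L = 1\<close> is enough for local
  integrability, while a height adapted to the radius of a ball gives the quantitative Morrey
  bound.\<close>

lemma set_nn_integral_norm_powr_le:
  fixes f :: "'a \<Rightarrow> 'b::{real_normed_field, euclidean_space}"
  assumes [measurable]: "f \<in> borel_measurable M" "S \<in> sets M"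
    and "0 < L" "1 \<le> q" "q \<le> p"
  shows "(\<integral>\<^sup>+ y \<in> S. ennreal (norm (f y) powr q) \<partial>M)
    \<le> ennreal (L powr q) * emeasure M S
      + ennreal (L powr (q - p)) * (\<integral>\<^sup>+ y \<in> S. ennreal (norm (f y) powr p) \<partial>M)"
proof -
  have "(\<integral>\<^sup>+ y \<in> S. ennreal (norm (f y) powr q) \<partial>M)
    \<le> (\<integral>\<^sup>+ y. ennreal (L powr q) * indicator S y
        + ennreal (L powr (q - p)) * (ennreal (norm (f y) powr p) * indicator S y) \<partial>M)"
  proof (intro nn_integral_mono)
    fix y
    have "ennreal (norm (f y) powr q)
        \<le> ennreal (L powr q) + ennreal (L powr (q - p)) * ennreal (norm (f y) powr p)"
      using powr_le_scaled_powr [of "norm (f y)" L q p] assms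
      by (simp add: ennreal_plus [symmetric] ennreal_mult' [symmetric] ennreal_leI del: ennreal_plus)
    then show "ennreal (norm (f y) powr q) * indicator S y
        \<le> ennreal (L powr q) * indicator S y
          + ennreal (L powr (q - p)) * (ennreal (norm (f y) powr p) * indicator S y)"
      by (auto simp: indicator_def)
  qed
  also have "\<dots> = ennreal (L powr q) * emeasure M S
      + ennreal (L powr (q - p)) * (\<integral>\<^sup>+ y \<in> S. ennreal (norm (f y) powr p) \<partial>M)"
    by (subst nn_integral_add) (auto simp: nn_integral_cmult nn_integral_cmult_indicator)
  finally show ?thesis .
qed

lemma Lp_loc_mono:
  assumes "1 \<le> q" "q \<le> p"
  shows "(Lp_loc p :: (real^'n \<Rightarrow> 'b::{real_normed_field, euclidean_space}) set) \<subseteq> Lp_loc q"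
proof
  fix f :: "real^'n \<Rightarrow> 'b" assume f: "f \<in> Lp_loc p"
  show "f \<in> Lp_loc q"
    unfolding Lp_loc_def
  proof (intro CollectI conjI allI impI)
    show meas: "f \<in> borel_measurable lebesgue" using f by (simp add: Lp_loc_def)
    fix K :: "(real^'n) set" assume K: "compact K"
    have fin: "(\<integral>\<^sup>+ y \<in> K. ennreal (norm (f y) powr p) \<partial>lebesgue) < \<infinity>"
      using f K by (simp add: Lp_loc_def)
    have "K \<in> lmeasurable" using K by (rule lmeasurable_compact)
    then have Kset: "K \<in> sets lebesgue" and Kfin: "emeasure lebesgue K < \<infinity>"
      by (auto simp: fmeasurable_def)
    have "(\<integral>\<^sup>+ y \<in> K. ennreal (norm (f y) powr q) \<partial>lebesgue)
      \<le> ennreal (1 powr q) * emeasure lebesgue K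
        + ennreal (1 powr (q - p)) * (\<integral>\<^sup>+ y \<in> K. ennreal (norm (f y) powr p) \<partial>lebesgue)"
      using meas Kset assms by (intro set_nn_integral_norm_powr_le) auto
    also have "\<dots> < \<infinity>" using fin Kfin by (simp add: ennreal_add_eq_top less_top)
    finally show "(\<integral>\<^sup>+ y \<in> K. ennreal (norm (f y) powr q) \<partial>lebesgue) < \<infinity>" .
  qed
qed

section \<open>Integrals over balls of functions in a Morrey space\<close>

text \<open>Frees the supremum in the Morrey norm from its roots: one finite \<open>N\<close> serves
  all centres and radii, and raising to the power \<open>p\<close> gives a bound on the integral
  itself.\<close>

lemma morrey_space_ball_bound:
  fixes f :: "real^'n \<Rightarrow> 'b::{real_normed_field, euclidean_space}"
  assumes f: "f \<in> morrey_space p \<Psi>" and p: "1 \<le> p" and pos: "\<forall>t>0. \<Psi> t > 0"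
  obtains N where "0 < N"
    "\<And>x r. 0 < r \<Longrightarrow> (\<integral>\<^sup>+ y \<in> ball x r. ennreal (norm (f y) powr p) \<partial>lebesgue)
        \<le> ennreal ((N * \<Psi> r) powr p * measure lebesgue (ball x r))"
proof
  \<comment> \<open>Adding 1 makes \<open>N\<close> strictly positive even when the norm vanishes,
    so that \<open>N * \<Psi> r\<close> can serve as a splitting height.\<close>
  define N where "N = enn2real (morrey_norm p \<Psi> f) + 1"
  show N: "0 < N" by (simp add: N_def add_nonneg_pos)
  have "morrey_norm p \<Psi> f < \<infinity>" using f by (simp add: morrey_space_def)
  then have "morrey_norm p \<Psi> f = ennreal (enn2real (morrey_norm p \<Psi> f))"
    by (simp add: less_top)
  then have norm_le: "morrey_norm p \<Psi> f \<le> ennreal N"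
    by (metis N_def ennreal_leI le_add_same_cancel1 zero_le_one)
  fix x :: "real^'n" and r :: real assume r: "0 < r"
  define m where "m = measure lebesgue (ball x r)"
  have m: "0 < m" using r unfolding m_def by (simp add: content_ball_pos)
  have \<Psi>r: "0 < \<Psi> r" using pos r by simp
  define I where "I = (\<integral>\<^sup>+ y \<in> ball x r. ennreal (norm (f y) powr p) \<partial>lebesgue)"
  have "ennreal (m powr (- 1 / p) / \<Psi> r) * ennpowr I (1 / p) \<le> morrey_norm p \<Psi> f"
    unfolding morrey_norm_def m_def I_def
    by (rule SUP_upper2 [OF UNIV_I], rule SUP_upper2 [where i = r]) (use r in auto)
  with norm_le have le: "ennreal (m powr (- 1 / p) / \<Psi> r) * ennpowr I (1 / p) \<le> ennreal N"
    by (rule order_trans [rotated])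
  \<comment> \<open>The coefficient of \<open>ennpowr I (1 / p)\<close> is positive, so an infinite
    \<open>I\<close> would make the product infinite. Hence passing to the real number
    \<open>i\<close> loses nothing.\<close>
  have Ifin: "I \<noteq> \<infinity>"
  proof
    assume "I = \<infinity>"
    then have "ennreal (m powr (- 1 / p) / \<Psi> r) * ennpowr I (1 / p) = \<infinity>"
      using m \<Psi>r by (simp add: ennpowr_def ennreal_mult_eq_top_iff)
    with le show False by (simp add: top_unique)
  qed
  define i where "i = enn2real I"
  have I: "I = ennreal i" and i: "0 \<le> i" using Ifin by (auto simp: i_def less_top)
  have "ennreal (m powr (- 1 / p) / \<Psi> r * i powr (1 / p)) \<le> ennreal N"
    using le Ifin \<Psi>r by (simp add: ennpowr_def ennreal_mult' [symmetric] i_def)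
  then have "m powr (- 1 / p) / \<Psi> r * i powr (1 / p) \<le> N"
    using N by (simp add: ennreal_le_iff)
  then have "i powr (1 / p) \<le> N * \<Psi> r * m powr (1 / p)"
    using m \<Psi>r by (simp add: powr_minus field_simps)
  then have "(i powr (1 / p)) powr p \<le> (N * \<Psi> r * m powr (1 / p)) powr p"
    using p by (intro powr_mono2) auto
  then have "i \<le> (N * \<Psi> r) powr p * m"
    using p m i N \<Psi>r by (simp add: powr_powr powr_mult)
  then show "(\<integral>\<^sup>+ y \<in> ball x r. ennreal (norm (f y) powr p) \<partial>lebesgue)
      \<le> ennreal ((N * \<Psi> r) powr p * measure lebesgue (ball x r))"
    by (fold I_def m_def) (simp add: I ennreal_leI)
qed

text \<open>Splitting at the height \<open>\<bar>f\<bar> = N \<Psi> r\<close> replaces Hoelder's inequality, at the cost of the factor 2.\<close>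

lemma morrey_space_ball_bound_lower_exponent:
  fixes f :: "real^'n \<Rightarrow> 'b::{real_normed_field, euclidean_space}"
  assumes f: "f \<in> morrey_space p \<Psi>" and "1 \<le> q" "q \<le> p" and pos: "\<forall>t>0. \<Psi> t > 0"
  obtains N where "0 < N"
    "\<And>x r. 0 < r \<Longrightarrow> (\<integral>\<^sup>+ y \<in> ball x r. ennreal (norm (f y) powr q) \<partial>lebesgue)
        \<le> ennreal (2 * (N * \<Psi> r) powr q * measure lebesgue (ball x r))"
proof -
  obtain N where N: "0 < N"
    and bound: "\<And>x r. 0 < r \<Longrightarrow> (\<integral>\<^sup>+ y \<in> ball x r. ennreal (norm (f y) powr p) \<partial>lebesgue)
        \<le> ennreal ((N * \<Psi> r) powr p * measure lebesgue (ball x r))"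
    using assms by (auto intro: morrey_space_ball_bound)
  show thesis
  proof (rule that [OF N])
    fix x :: "real^'n" and r :: real assume r: "0 < r"
    define m where "m = measure lebesgue (ball x r)"
    define L where "L = N * \<Psi> r"
    have m0: "0 \<le> m" by (simp add: m_def)
    have m: "emeasure lebesgue (ball x r) = ennreal m"
      unfolding m_def by (intro emeasure_eq_measure2) simp
    have L: "0 < L" using N pos r by (simp add: L_def)
    have "(\<integral>\<^sup>+ y \<in> ball x r. ennreal (norm (f y) powr q) \<partial>lebesgue)
      \<le> ennreal (L powr q) * emeasure lebesgue (ball x r) + ennreal (L powr (q - p)) *
          (\<integral>\<^sup>+ y \<in> ball x r. ennreal (norm (f y) powr p) \<partial>lebesgue)"
      using f assms L
      by (intro set_nn_integral_norm_powr_le) (auto simp: morrey_space_def Lp_loc_def)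
    also have "\<dots> \<le> ennreal (L powr q) * ennreal m
        + ennreal (L powr (q - p)) * ennreal (L powr p * m)"
      using bound [OF r, of x] unfolding m L_def m_def by (intro add_mono mult_left_mono) auto
    also have "\<dots> = ennreal (L powr q * m + L powr (q - p) * L powr p * m)"
      using m0 by (simp add: ennreal_mult' [symmetric] ennreal_plus [symmetric] mult.assoc
          del: ennreal_plus)
    \<comment> \<open>The exponents \<open>q - p\<close> and \<open>p\<close> add up to
      \<open>q\<close>, so with this height both terms coincide.\<close>
    also have "L powr q * m + L powr (q - p) * L powr p * m = 2 * L powr q * m"
      by (simp add: powr_add [symmetric])
    finally show "(\<integral>\<^sup>+ y \<in> ball x r. ennreal (norm (f y) powr q) \<partial>lebesgue)
        \<le> ennreal (2 * (N * \<Psi> r) powr q * measure lebesgue (ball x r))"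
      by (simp add: L_def m_def)
  qed
qed

section \<open>The kernel bound and the exchange of integrals\<close>

text \<open>For \<open>s/2 < t \<le> s\<close> the ratio \<open>s / t\<close> lies between 1 and 2,
  so \<open>\<Psi> s \<le> A * \<Psi> t\<close>, and \<open>t\<close> is the smaller denominator.
  The factor 2 compensates for the length \<open>s / 2\<close> of the interval.\<close>

lemma doubling_kernel_le:
  fixes \<Psi> :: "real \<Rightarrow> real"
  assumes A: "0 < A" and s: "0 < s" and pos: "\<forall>t>0. \<Psi> t > 0"
    and dbl: "\<forall>r>0. \<forall>s>0. 1 \<le> s / r \<and> s / r \<le> 2 \<longrightarrow> \<Psi> s / \<Psi> r \<le> A"
  shows "ennreal (\<Psi> s / s ^ n)
    \<le> (\<integral>\<^sup>+ t \<in> {s/2<..s}. ennreal (2 * A * \<Psi> t / t ^ Suc n) \<partial>lebesgue)"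
proof -
  have "ennreal (\<Psi> s / s ^ n) = ennreal (2 * \<Psi> s / s ^ Suc n) * ennreal (s / 2)"
    using s pos by (subst ennreal_mult' [symmetric]) auto
  also have "ennreal (s / 2) = emeasure lebesgue {s/2<..s}"
    using s by (simp add: emeasure_lborel_Ioc)
  also have "ennreal (2 * \<Psi> s / s ^ Suc n) * \<dots>
      = (\<integral>\<^sup>+ t \<in> {s/2<..s}. ennreal (2 * \<Psi> s / s ^ Suc n) \<partial>lebesgue)"
    by (simp add: nn_integral_cmult_indicator)
  also have "\<dots> \<le> (\<integral>\<^sup>+ t \<in> {s/2<..s}. ennreal (2 * A * \<Psi> t / t ^ Suc n) \<partial>lebesgue)"
  proof (intro nn_integral_mono)
    fix t
    have "2 * \<Psi> s / s ^ Suc n \<le> 2 * A * \<Psi> t / t ^ Suc n" if t: "s / 2 < t" "t \<le> s"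
    proof -
      have t0: "0 < t" using s t by simp
      have "\<Psi> s / \<Psi> t \<le> A" using dbl t t0 s by (simp add: field_simps)
      then have "\<Psi> s \<le> A * \<Psi> t" using pos t0 by (simp add: field_simps)
      moreover have "t ^ Suc n \<le> s ^ Suc n" using t t0 by (intro power_mono) auto
      moreover have "0 < \<Psi> t" "0 < \<Psi> s" using pos s t0 by auto
      ultimately show ?thesis using t0 A by (intro frac_le) (auto simp del: power_Suc)
    qed
    then show "ennreal (2 * \<Psi> s / s ^ Suc n) * indicator {s/2<..s} t
        \<le> ennreal (2 * A * \<Psi> t / t ^ Suc n) * indicator {s/2<..s} t"
      by (auto simp: indicator_def intro!: ennreal_leI)
  qed
  finally show ?thesis .
qed

text \<open>Extension by zero carries measurability from the half-line to the whole line, over which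
  all integrals are taken.\<close>

lemma borel_measurable_times_indicator_Ioi:
  fixes g :: "real \<Rightarrow> real"
  assumes "g \<in> borel_measurable (lebesgue_on {0<..})"
  shows "(\<lambda>t. g t * indicator {0<..} t) \<in> borel_measurable lebesgue"
  using assms by (subst (asm) borel_measurable_restrict_space_iff) (auto simp: mult.commute)

text \<open>Completion leaves the measure of the original sets unchanged, so the same countable
  cover works. This makes Fubini available for \<open>lebesgue\<close>.\<close>

lemma sigma_finite_completion:
  assumes "sigma_finite_measure M"
  shows "sigma_finite_measure (completion M)"
proof -
  interpret sigma_finite_measure M by fact
  obtain A where "countable A" "A \<subseteq> sets M" "\<Union>A = space M" "\<forall>a\<in>A. emeasure M a \<noteq> \<infinity>"
    using sigma_finite_countable by blast
  then show ?thesis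
    by unfold_locales (intro exI [of _ A], auto simp: subset_eq)
qed

text \<open>After the kernel bound is inserted, Tonelli's theorem turns the constraint
  \<open>norm (x - y) / 2 < t\<close> into \<open>y\<close> lying in the ball of radius
  \<open>2 * t\<close>.\<close>

lemma stummel_integral_le:
  fixes f :: "real^'n \<Rightarrow> 'b::{real_normed_field, euclidean_space}"
  assumes f: "f \<in> borel_measurable lebesgue" and A: "0 < A"
    and meas: "\<Psi> \<in> borel_measurable (lebesgue_on {0<..})" and pos: "\<forall>t>0. \<Psi> t > 0"
    and dbl: "\<forall>r>0. \<forall>s>0. 1 \<le> s / r \<and> s / r \<le> 2 \<longrightarrow> \<Psi> s / \<Psi> r \<le> A"
  shows "(\<integral>\<^sup>+ y \<in> {y. norm (x - y) < r}.
      ennreal (norm (f y) powr p * \<Psi> (norm (x - y)) / norm (x - y) ^ CARD('n)) \<partial>lebesgue)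
    \<le> (\<integral>\<^sup>+ t \<in> {0<..<r}. ennreal (2 * A * \<Psi> t / t ^ Suc CARD('n))
        * (\<integral>\<^sup>+ y \<in> ball x (2 * t). ennreal (norm (f y) powr p) \<partial>lebesgue) \<partial>lebesgue)"
proof -
  define n where "n = CARD('n)"
  \<comment> \<open>The zero extension makes \<open>G\<close> measurable on the whole line. It
    changes nothing on \<open>Z\<close>, where \<open>t\<close> is positive.\<close>
  define G where "G t = ennreal (2 * A * (\<Psi> t * indicator {0<..} t) / t ^ Suc n)" for t
  define F where "F y = ennreal (norm (f y) powr p)" for y
  \<comment> \<open>For fixed \<open>y\<close> with \<open>norm (x - y) < r\<close>, the section of
    \<open>Z\<close> is the interval of the kernel bound; for fixed \<open>t\<close> it lies in
    \<open>ball x (2 * t)\<close> and is empty unless \<open>0 < t < r\<close>.\<close>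
  define Z :: "((real^'n) \<times> real) set" where
    "Z = {(y, t). norm (x - y) / 2 < t \<and> t \<le> norm (x - y) \<and> norm (x - y) < r}"
  have id_t [measurable]: "(\<lambda>t::real. t) \<in> borel_measurable lebesgue"
    and id_y [measurable]: "(\<lambda>y::real^'n. y) \<in> borel_measurable lebesgue"
    by (auto intro: measurable_completion)
  note [measurable] = f borel_measurable_times_indicator_Ioi [OF meas]
  have [measurable]: "G \<in> borel_measurable lebesgue" "F \<in> borel_measurable lebesgue"
    unfolding G_def F_def by measurable
  \<comment> \<open>The product is that of the completed sigma-algebras, so each coordinate map is
    first composed with its projection.\<close>
  have [measurable]: "Z \<in> sets (lebesgue \<Otimes>\<^sub>M lebesgue)"
  proof -
    have [measurable]: "(\<lambda>y. norm (x - y)) \<in> borel_measurable lebesgue" by measurable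
    have [measurable]: "(\<lambda>z. norm (x - fst z))
        \<in> borel_measurable (lebesgue \<Otimes>\<^sub>M (lebesgue :: real measure))"
      by (rule measurable_compose [OF measurable_fst]) measurable
    have [measurable]: "snd
        \<in> borel_measurable ((lebesgue :: (real^'n) measure) \<Otimes>\<^sub>M (lebesgue :: real measure))"
      using measurable_compose [OF measurable_snd id_t] by simp
    have "Z = {z \<in> space (lebesgue \<Otimes>\<^sub>M lebesgue). norm (x - fst z) / 2 < snd z \<and>
        snd z \<le> norm (x - fst z) \<and> norm (x - fst z) < r}"
      by (auto simp: Z_def space_pair_measure)
    then show ?thesis by simp
  qed
  interpret y: sigma_finite_measure "lebesgue :: (real^'n) measure"
    by (rule sigma_finite_completion [OF sigma_finite_lborel])
  interpret t: sigma_finite_measure "lebesgue :: real measure"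
    by (rule sigma_finite_completion [OF sigma_finite_lborel])
  interpret yt: pair_sigma_finite "lebesgue :: (real^'n) measure" "lebesgue :: real measure" ..
  have "(\<integral>\<^sup>+ y \<in> {y. norm (x - y) < r}.
      ennreal (norm (f y) powr p * \<Psi> (norm (x - y)) / norm (x - y) ^ n) \<partial>lebesgue)
    \<le> (\<integral>\<^sup>+ y. F y * (\<integral>\<^sup>+ t. G t * indicator Z (y, t) \<partial>lebesgue) \<partial>lebesgue)"
  proof (intro nn_integral_mono)
    fix y
    define s where "s = norm (x - y)"
    show "ennreal (norm (f y) powr p * \<Psi> (norm (x - y)) / norm (x - y) ^ n)
          * indicator {y. norm (x - y) < r} y
        \<le> F y * (\<integral>\<^sup>+ t. G t * indicator Z (y, t) \<partial>lebesgue)"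
    proof (cases "0 < s \<and> s < r")
      case True
      then have "ennreal (\<Psi> s / s ^ n)
          \<le> (\<integral>\<^sup>+ t \<in> {s/2<..s}. ennreal (2 * A * \<Psi> t / t ^ Suc n) \<partial>lebesgue)"
        using A pos dbl by (intro doubling_kernel_le) auto
      also have "\<dots> = (\<integral>\<^sup>+ t. G t * indicator Z (y, t) \<partial>lebesgue)"
        using True by (intro nn_integral_cong) (auto simp: G_def Z_def s_def indicator_def)
      finally have "F y * ennreal (\<Psi> s / s ^ n) \<le> F y * (\<integral>\<^sup>+ t. G t * indicator Z (y, t) \<partial>lebesgue)"
        by (rule mult_left_mono) simp
      moreover have "F y * ennreal (\<Psi> s / s ^ n) = ennreal (norm (f y) powr p * \<Psi> s / s ^ n)"
        by (simp add: F_def ennreal_mult' [symmetric])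
      ultimately show ?thesis using True by (simp add: s_def)
    next
      \<comment> \<open>Either \<open>s \<ge> r\<close> and the indicator vanishes, or
        \<open>s = 0\<close> and the integrand is 0 by division by zero, the dimension being
        positive.\<close>
      case False
      then show ?thesis
        by (cases "s = 0") (auto simp: s_def n_def zero_power [OF zero_less_card_finite])
    qed
  qed
  also have "\<dots> = (\<integral>\<^sup>+ y. (\<integral>\<^sup>+ t. F y * (G t * indicator Z (y, t)) \<partial>lebesgue) \<partial>lebesgue)"
    by (intro nn_integral_cong nn_integral_cmult [symmetric]) measurable
  also have "\<dots> = (\<integral>\<^sup>+ t. (\<integral>\<^sup>+ y. F y * (G t * indicator Z (y, t)) \<partial>lebesgue) \<partial>lebesgue)"
    by (rule yt.Fubini'[symmetric]) measurable
  also have "\<dots> \<le> (\<integral>\<^sup>+ t \<in> {0<..<r}. ennreal (2 * A * \<Psi> t / t ^ Suc n)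
        * (\<integral>\<^sup>+ y \<in> ball x (2 * t). F y \<partial>lebesgue) \<partial>lebesgue)"
  proof (intro nn_integral_mono)
    fix t
    show "(\<integral>\<^sup>+ y. F y * (G t * indicator Z (y, t)) \<partial>lebesgue)
      \<le> ennreal (2 * A * \<Psi> t / t ^ Suc n)
        * (\<integral>\<^sup>+ y \<in> ball x (2 * t). F y \<partial>lebesgue) * indicator {0<..<r} t"
    proof (cases "0 < t \<and> t < r")
      case True
      have "(\<integral>\<^sup>+ y. F y * (G t * indicator Z (y, t)) \<partial>lebesgue)
          \<le> (\<integral>\<^sup>+ y. G t * (F y * indicator (ball x (2 * t)) y) \<partial>lebesgue)"
        by (intro nn_integral_mono)
          (auto simp: Z_def indicator_def dist_norm mult.commute split: if_splits)
      also have "\<dots> = G t * (\<integral>\<^sup>+ y \<in> ball x (2 * t). F y \<partial>lebesgue)"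
        by (intro nn_integral_cmult borel_measurable_times_ennreal borel_measurable_indicator) auto
      finally show ?thesis using True by (simp add: G_def)
    next
      case False
      \<comment> \<open>Membership in \<open>Z\<close> forces
        \<open>0 \<le> norm (x - y) / 2 < t\<close> and
        \<open>t \<le> norm (x - y) < r\<close>.\<close>
      have "(y, t) \<notin> Z" for y
        using False norm_ge_zero [of "x - y"] unfolding Z_def by auto
      then show ?thesis by simp
    qed
  qed
  finally show ?thesis by (simp add: n_def F_def)
qed

section \<open>Limits as the radius tends to 0\<close>

text \<open>Dominated convergence gives the limit along the radii \<open>inverse (Suc k)\<close>,
  with the integrand on the unit interval as majorant; monotonicity in \<open>r\<close> extends it
  to all small radii.\<close>

lemma set_nn_integral_Ioo_tendsto_0:
  fixes h :: "real \<Rightarrow> ennreal"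
  assumes meas: "(\<lambda>t. h t * indicator {0<..<1} t) \<in> borel_measurable lebesgue"
    and fin: "(\<integral>\<^sup>+ t \<in> {0<..<1}. h t \<partial>lebesgue) < \<infinity>"
  shows "((\<lambda>r. \<integral>\<^sup>+ t \<in> {0<..<r}. h t \<partial>lebesgue) \<longlongrightarrow> 0) (at_right 0)"
proof -
  define H where "H r = (\<integral>\<^sup>+ t \<in> {0<..<r}. h t \<partial>lebesgue)" for r
  have mono: "H r \<le> H s" if "r \<le> s" for r s
    unfolding H_def using that by (intro nn_integral_mono) (auto simp: indicator_def)
  have "(\<lambda>k. \<integral>\<^sup>+ t. h t * indicator {0<..<1} t * indicator {0<..<inverse (Suc k)} t \<partial>lebesgue)
      \<longlonglongrightarrow> (\<integral>\<^sup>+ t. 0 \<partial>(lebesgue :: real measure))"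
  proof (rule nn_integral_dominated_convergence [where w = "\<lambda>t. h t * indicator {0<..<1} t"])
    show "AE t in lebesgue.
        (\<lambda>k. h t * indicator {0<..<1} t * indicator {0<..<inverse (Suc k)} t)
        \<longlonglongrightarrow> 0"
    proof (rule AE_I2)
      fix t :: real
      \<comment> \<open>Each \<open>t\<close> eventually leaves the shrinking intervals, so the
        integrands are eventually equal to 0 at \<open>t\<close>.\<close>
      have "\<forall>\<^sub>F k in sequentially. t \<notin> {0<..<inverse (Suc k)}"
      proof (cases "0 < t")
        case True
        have "\<forall>\<^sub>F k in sequentially. inverse (real (Suc k)) < t"
          using LIMSEQ_inverse_real_of_nat True by (rule order_tendstoD)
        then show ?thesis by (rule eventually_mono) auto
      qed simp
      then have "\<forall>\<^sub>F k in sequentially.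
          h t * indicator {0<..<1} t * indicator {0<..<inverse (Suc k)} t = 0"
        by (rule eventually_mono) (simp add: indicator_def)
      then show "(\<lambda>k. h t * indicator {0<..<1} t * indicator {0<..<inverse (Suc k)} t)
        \<longlonglongrightarrow> 0"
        by (rule tendsto_eventually)
    qed
    show "(\<lambda>t. h t * indicator {0<..<1} t * indicator {0<..<inverse (Suc k)} t)
        \<in> borel_measurable lebesgue" for k
      by (intro borel_measurable_times_ennreal [OF meas] borel_measurable_indicator) auto
    show "AE t in lebesgue. h t * indicator {0<..<1} t * indicator {0<..<inverse (Suc k)} t
        \<le> h t * indicator {0<..<1} t" for k
      by (auto split: split_indicator)
  qed (use assms in simp_all)
  moreover have "(\<integral>\<^sup>+ t. h t * indicator {0<..<1} t * indicator {0<..<inverse (Suc k)} t \<partial>lebesgue)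
      = H (inverse (Suc k))" for k
  proof -
    have "inverse (real (Suc k)) \<le> 1" by (simp add: field_simps)
    then show ?thesis
      unfolding H_def by (intro nn_integral_cong) (auto simp: indicator_def)
  qed
  ultimately have lim: "(\<lambda>k. H (inverse (Suc k))) \<longlonglongrightarrow> 0" by simp
  have "(H \<longlongrightarrow> 0) (at_right 0)"
  proof (rule order_tendstoI)
    fix a :: ennreal assume "0 < a"
    then have "\<forall>\<^sub>F k in sequentially. H (inverse (Suc k)) < a"
      by (rule order_tendstoD [OF lim])
    then obtain k where k: "H (inverse (Suc k)) < a"
      by (auto simp: eventually_sequentially)
    have "\<forall>\<^sub>F r in at_right 0. r < inverse (real (Suc k))"
      by (rule eventually_at_right_real [THEN eventually_mono]) auto
    then show "\<forall>\<^sub>F r in at_right 0. H r < a"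
      by (rule eventually_mono) (use k mono less_imp_le le_less_trans in blast)
  qed simp
  then show ?thesis by (simp add: H_def [abs_def])
qed

text \<open>The finite bound excludes the infinite branch of \<open>ennpowr\<close>, which leaves
  monotonicity of real powers.\<close>

lemma ennpowr_le:
  assumes "0 < q" "0 \<le> e" "I \<le> ennreal (e powr q)"
  shows "ennpowr I (1 / q) \<le> ennreal e"
proof -
  have I: "I < \<infinity>" using assms(3) by (rule le_less_trans) simp
  have "enn2real I \<le> e powr q"
    using enn2real_mono [OF assms(3)] by simp
  then have "enn2real I powr (1 / q) \<le> (e powr q) powr (1 / q)"
    using assms by (intro powr_mono2) auto
  then have "enn2real I powr (1 / q) \<le> e" using assms by (simp add: powr_powr)
  then show ?thesis using I by (auto simp: ennpowr_def ennreal_leI)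
qed

text \<open>The majorant \<open>H\<close> does not depend on the centre, so the bound survives the
  supremum over \<open>x\<close>.\<close>

lemma stummel_modulus_tendsto_0:
  fixes f :: "real^'n \<Rightarrow> 'b::{real_normed_field, euclidean_space}"
  assumes p: "0 < p" and H: "(H \<longlongrightarrow> 0) (at_right 0)"
    and bound: "\<And>x r. 0 < r \<Longrightarrow> (\<integral>\<^sup>+ y \<in> {y. norm (x - y) < r}.
      ennreal (norm (f y) powr p * \<Psi> (norm (x - y)) / norm (x - y) ^ CARD('n)) \<partial>lebesgue) \<le> H r"
  shows "(stummel_modulus p \<Psi> f \<longlongrightarrow> 0) (at_right 0)"
proof (rule order_tendstoI)
  fix a :: ennreal assume "0 < a"
  \<comment> \<open>A supremum of values below a level may attain that level. An intermediate
    \<open>b\<close> restores the strict inequality, and \<open>b < a\<close> makes it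
    finite.\<close>
  then obtain b where b: "0 < b" "b < a" using dense by blast
  define e where "e = enn2real b"
  have "b < top" using b(2) top_greatest by (rule less_le_trans)
  then have be: "b = ennreal e" by (simp add: e_def)
  with b have e: "0 < e" by simp
  then have "\<forall>\<^sub>F r in at_right 0. H r < ennreal (e powr p)"
    by (intro order_tendstoD [OF H]) simp
  moreover have "\<forall>\<^sub>F r::real in at_right 0. 0 < r" by (rule eventually_at_right_less)
  ultimately show "\<forall>\<^sub>F r in at_right 0. stummel_modulus p \<Psi> f r < a"
  proof eventually_elim
    case (elim r)
    have "stummel_modulus p \<Psi> f r \<le> ennreal e"
      unfolding stummel_modulus_def
      by (intro SUP_least ennpowr_le p less_imp_le [OF e])
        (use bound [of r] elim in \<open>auto intro: order_trans less_imp_le\<close>)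
    then show ?case using b be by simp
  qed
qed simp

section \<open>Assembling the estimates into the inclusion\<close>

theorem theorem4p1:
  fixes p\<^sub>1 p\<^sub>2 :: real and \<Psi>\<^sub>1 \<Psi>\<^sub>2 :: "real \<Rightarrow> real"
  assumes "1 \<le> p\<^sub>2" and "p\<^sub>2 \<le> p\<^sub>1"
    and "\<Psi>\<^sub>1 \<in> borel_measurable (lebesgue_on {0<..})" and "\<forall>t>0. \<Psi>\<^sub>1 t > 0"
    and "\<Psi>\<^sub>2 \<in> borel_measurable (lebesgue_on {0<..})" and "\<forall>t>0. \<Psi>\<^sub>2 t > 0"
    and "\<exists>A\<^sub>1>0. \<forall>r>0. \<forall>s>0. 1 \<le> s / r \<and> s / r \<le> 2 \<longrightarrow>
           1 / A\<^sub>1 \<le> \<Psi>\<^sub>1 s / \<Psi>\<^sub>1 r \<and> \<Psi>\<^sub>1 s / \<Psi>\<^sub>1 r \<le> A\<^sub>1"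
    and "\<exists>A\<^sub>3>0. \<forall>r>0. \<forall>s>0. 1 \<le> s / r \<and> s / r \<le> 2 \<longrightarrow> \<Psi>\<^sub>2 s / \<Psi>\<^sub>2 r \<le> A\<^sub>3"
    and "(\<integral>\<^sup>+ t \<in> {0<..<1}. ennreal (\<Psi>\<^sub>1 t powr p\<^sub>2 * \<Psi>\<^sub>2 t / t) \<partial>lebesgue) < \<infinity>"
  shows "(morrey_space p\<^sub>1 \<Psi>\<^sub>1 :: (real^'n \<Rightarrow> 'b::{real_normed_field, euclidean_space}) set)
           \<subseteq> stummel_class p\<^sub>2 \<Psi>\<^sub>2"
proof
  fix f :: "real^'n \<Rightarrow> 'b" assume f: "f \<in> morrey_space p\<^sub>1 \<Psi>\<^sub>1"
  note pos1 = \<open>\<forall>t>0. \<Psi>\<^sub>1 t > 0\<close> and pos2 = \<open>\<forall>t>0. \<Psi>\<^sub>2 t > 0\<close>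
  obtain A\<^sub>1 where A1: "0 < A\<^sub>1"
    and dbl1: "\<And>r s. \<lbrakk>0 < r; 0 < s; 1 \<le> s / r; s / r \<le> 2\<rbrakk> \<Longrightarrow> \<Psi>\<^sub>1 s / \<Psi>\<^sub>1 r \<le> A\<^sub>1"
    using assms(7) by blast
  obtain A\<^sub>3 where A3: "0 < A\<^sub>3"
    and dbl2: "\<forall>r>0. \<forall>s>0. 1 \<le> s / r \<and> s / r \<le> 2 \<longrightarrow> \<Psi>\<^sub>2 s / \<Psi>\<^sub>2 r \<le> A\<^sub>3"
    using assms(8) by blast
  have floc: "f \<in> Lp_loc p\<^sub>2"
    using f Lp_loc_mono assms(1,2) by (auto simp: morrey_space_def)
  then have fmeas: "f \<in> borel_measurable lebesgue" by (simp add: Lp_loc_def)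
  obtain N where N: "0 < N"
    and ball_bound: "\<And>x r. 0 < r \<Longrightarrow> (\<integral>\<^sup>+ y \<in> ball x r. ennreal (norm (f y) powr p\<^sub>2) \<partial>lebesgue)
        \<le> ennreal (2 * (N * \<Psi>\<^sub>1 r) powr p\<^sub>2 * measure lebesgue (ball x r))"
    using f assms(1,2) pos1 by (auto intro: morrey_space_ball_bound_lower_exponent)
  define n where "n = CARD('n)"
  \<comment> \<open>The ball of radius \<open>2 * t\<close> has volume
    \<open>w * t ^ n\<close>.\<close>
  define w where "w = unit_ball_vol (real n) * 2 ^ n"
  have w: "0 < w" by (simp add: w_def)
  define h where "h t = ennreal (\<Psi>\<^sub>1 t powr p\<^sub>2 * \<Psi>\<^sub>2 t / t)" for t
  \<comment> \<open>The kernel bound contributes \<open>2 * A\<^sub>3\<close>, the lowered exponent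
    another 2, the Morrey bound and the doubling of \<open>\<Psi>\<^sub>1\<close> contribute
    \<open>(N * A\<^sub>1) powr p\<^sub>2\<close>, and the volume of the ball gives
    \<open>w\<close>.\<close>
  define K where "K = 4 * A\<^sub>3 * (N * A\<^sub>1) powr p\<^sub>2 * w"
  have h_meas: "(\<lambda>t. h t * indicator {0<..<r} t) \<in> borel_measurable lebesgue" for r
  proof -
    note [measurable] = borel_measurable_times_indicator_Ioi [OF assms(3)]
      borel_measurable_times_indicator_Ioi [OF assms(5)]
    have [measurable]: "(\<lambda>t::real. t) \<in> borel_measurable lebesgue"
      by (auto intro: measurable_completion)
    have "(\<lambda>t. h t * indicator {0<..<r} t) = (\<lambda>t. ennreal ((\<Psi>\<^sub>1 t * indicator {0<..} t) powr p\<^sub>2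
        * (\<Psi>\<^sub>2 t * indicator {0<..} t) / t) * indicator {0<..<r} t)"
      by (auto simp: h_def indicator_def fun_eq_iff)
    then show ?thesis by simp
  qed
  have bound: "(\<integral>\<^sup>+ y \<in> {y. norm (x - y) < r}. ennreal (norm (f y) powr p\<^sub>2
        * \<Psi>\<^sub>2 (norm (x - y)) / norm (x - y) ^ CARD('n)) \<partial>lebesgue)
      \<le> ennreal K * (\<integral>\<^sup>+ t \<in> {0<..<r}. h t \<partial>lebesgue)" for x r
  proof -
    have "(\<integral>\<^sup>+ y \<in> {y. norm (x - y) < r}. ennreal (norm (f y) powr p\<^sub>2
          * \<Psi>\<^sub>2 (norm (x - y)) / norm (x - y) ^ CARD('n)) \<partial>lebesgue)
      \<le> (\<integral>\<^sup>+ t \<in> {0<..<r}. ennreal (2 * A\<^sub>3 * \<Psi>\<^sub>2 t / t ^ Suc CARD('n))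
        * (\<integral>\<^sup>+ y \<in> ball x (2 * t). ennreal (norm (f y) powr p\<^sub>2) \<partial>lebesgue) \<partial>lebesgue)"
      using fmeas A3 assms(5) pos2 dbl2 by (rule stummel_integral_le)
    also have "\<dots> \<le> (\<integral>\<^sup>+ t. ennreal K * (h t * indicator {0<..<r} t) \<partial>lebesgue)"
    proof (intro nn_integral_mono)
      fix t
      have "ennreal (2 * A\<^sub>3 * \<Psi>\<^sub>2 t / t ^ Suc n)
          * (\<integral>\<^sup>+ y \<in> ball x (2 * t). ennreal (norm (f y) powr p\<^sub>2) \<partial>lebesgue) \<le> ennreal K * h t"
        if t: "0 < t"
      proof -
        have ps: "0 < \<Psi>\<^sub>1 t" "0 < \<Psi>\<^sub>1 (2 * t)" "0 < \<Psi>\<^sub>2 t" using pos1 pos2 t by auto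
        have vol: "measure lebesgue (ball x (2 * t)) = w * t ^ n"
          using t by (simp add: content_ball w_def n_def power_mult_distrib)
        \<comment> \<open>The ball has radius \<open>2 * t\<close>, whereas the Dini integrand is
          evaluated at \<open>t\<close>; the ratio is exactly the endpoint 2 of the doubling
          range.\<close>
        have "\<Psi>\<^sub>1 (2 * t) \<le> A\<^sub>1 * \<Psi>\<^sub>1 t"
          using dbl1 [of t "2 * t"] t ps by (simp add: field_simps)
        then have "(N * \<Psi>\<^sub>1 (2 * t)) powr p\<^sub>2 \<le> (N * A\<^sub>1 * \<Psi>\<^sub>1 t) powr p\<^sub>2"
          using N ps assms(1) by (intro powr_mono2) auto
        also have "\<dots> = (N * A\<^sub>1) powr p\<^sub>2 * \<Psi>\<^sub>1 t powr p\<^sub>2"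
          using N A1 ps by (simp add: powr_mult)
        finally have le: "(N * \<Psi>\<^sub>1 (2 * t)) powr p\<^sub>2 \<le> (N * A\<^sub>1) powr p\<^sub>2 * \<Psi>\<^sub>1 t powr p\<^sub>2" .
        have "ennreal (2 * A\<^sub>3 * \<Psi>\<^sub>2 t / t ^ Suc n)
            * (\<integral>\<^sup>+ y \<in> ball x (2 * t). ennreal (norm (f y) powr p\<^sub>2) \<partial>lebesgue)
          \<le> ennreal (2 * A\<^sub>3 * \<Psi>\<^sub>2 t / t ^ Suc n)
            * ennreal (2 * (N * \<Psi>\<^sub>1 (2 * t)) powr p\<^sub>2 * (w * t ^ n))"
          using ball_bound [of "2 * t" x] t by (intro mult_left_mono) (auto simp: vol)
        also have "\<dots> \<le> ennreal (2 * A\<^sub>3 * \<Psi>\<^sub>2 t / t ^ Suc n)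
            * ennreal (2 * ((N * A\<^sub>1) powr p\<^sub>2 * \<Psi>\<^sub>1 t powr p\<^sub>2) * (w * t ^ n))"
          using le w t by (intro mult_left_mono ennreal_leI mult_right_mono) auto
        also have "\<dots> = ennreal (2 * A\<^sub>3 * \<Psi>\<^sub>2 t / t ^ Suc n
            * (2 * ((N * A\<^sub>1) powr p\<^sub>2 * \<Psi>\<^sub>1 t powr p\<^sub>2) * (w * t ^ n)))"
          using A3 ps t by (intro ennreal_mult' [symmetric]) auto
        \<comment> \<open>The volume factor \<open>t ^ n\<close> cancels all but one power of
          \<open>t\<close> in the kernel, which leaves the \<open>1 / t\<close> of the Dini
          integrand.\<close>
        also have "2 * A\<^sub>3 * \<Psi>\<^sub>2 t / t ^ Suc n
              * (2 * ((N * A\<^sub>1) powr p\<^sub>2 * \<Psi>\<^sub>1 t powr p\<^sub>2) * (w * t ^ n))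
            = K * (\<Psi>\<^sub>1 t powr p\<^sub>2 * \<Psi>\<^sub>2 t / t)"
          using t by (simp add: K_def)
        also have "ennreal \<dots> = ennreal K * h t"
          using A3 w unfolding h_def by (intro ennreal_mult') (auto simp: K_def)
        finally show ?thesis .
      qed
      then show "ennreal (2 * A\<^sub>3 * \<Psi>\<^sub>2 t / t ^ Suc CARD('n))
          * (\<integral>\<^sup>+ y \<in> ball x (2 * t). ennreal (norm (f y) powr p\<^sub>2) \<partial>lebesgue) * indicator {0<..<r} t
        \<le> ennreal K * (h t * indicator {0<..<r} t)"
        by (auto simp: indicator_def n_def)
    qed
    also have "\<dots> = ennreal K * (\<integral>\<^sup>+ t \<in> {0<..<r}. h t \<partial>lebesgue)"
      using h_meas by (rule nn_integral_cmult)
    finally show ?thesis .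
  qed
  have "((\<lambda>r. \<integral>\<^sup>+ t \<in> {0<..<r}. h t \<partial>lebesgue) \<longlongrightarrow> 0) (at_right 0)"
    using h_meas assms(9) unfolding h_def by (rule set_nn_integral_Ioo_tendsto_0)
  \<comment> \<open>Multiplication by \<open>ennreal K\<close> preserves the limit 0 because this
    constant is finite.\<close>
  then have "((\<lambda>r. ennreal K * (\<integral>\<^sup>+ t \<in> {0<..<r}. h t \<partial>lebesgue)) \<longlongrightarrow> ennreal K * 0) (at_right 0)"
    by (intro ennreal_tendsto_cmult) auto
  then have "(stummel_modulus p\<^sub>2 \<Psi>\<^sub>2 f \<longlongrightarrow> 0) (at_right 0)"
    using assms(1) by (intro stummel_modulus_tendsto_0 [OF _ _ bound]) auto
  with floc show "f \<in> stummel_class p\<^sub>2 \<Psi>\<^sub>2" by (simp add: stummel_class_def)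
qed

end
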